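(* Let $V$ be a real vector space of finite dimension $n \geq 2$ with a positive definite inner product $\langle\cdot,\cdot\rangle$. Let $\varphi$ be a symmetric bilinear form on $V$, and let $\lambda_1, \ldots, \lambda_n$ be the eigenvalues of $\varphi$, repeated according to multiplicity. Let $m$ and $M$ be, respectively, the minimum and the maximum of the set $\{\lambda_i\lambda_j \mid i \neq j\}$. Then the set of sectional curvatures of $R_\varphi$, namely $\{\kappa(\pi) \mid \pi \text{ a 2-plane in } V\}$, is precisely the closed interval $[m, M]$.
   Context: For a symmetric bilinear form $\varphi$ on $V$, the canonical algebraic curvature tensor $R_\varphi \in \otimes^4 V^*$ is $R_\varphi(x,y,z,w) = \varphi(x,w)\varphi(y,z) - \varphi(x,z)\varphi(y,w)$. The eigenvalues (and eigenvectors, multiplicities) of $\varphi$ are those of the self-adjoint linear map $A: V \to V$ determined by $\varphi(x,y) = \langle Ax, y\rangle$. A 2-plane is a 2-dimensional linear subspace $\pi \subseteq V$; its sectional curvature with respect to $R_\varphi$ is $\kappa(\pi) = \dfrac{R_\varphi(x,y,y,x)}{\langle x,x\rangle\langle y,y\rangle - \langle x,y\rangle^2}$, where $\{x,y\}$ is any basis of $\pi$ (the value is independent of the basis). *)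

theory Defs
  imports "HOL-Analysis.Analysis" "HOL-Library.Multiset"
begin

text \<open>The ambient space \<open>V\<close> is a type of class \<^class>\<open>euclidean_space\<close>.\<close>

definition canonical_curvature ::
    "('a \<Rightarrow> 'a \<Rightarrow> real) \<Rightarrow> 'a \<Rightarrow> 'a \<Rightarrow> 'a \<Rightarrow> 'a \<Rightarrow> real" where
  "canonical_curvature \<phi> x y z w = \<phi> x w * \<phi> y z - \<phi> x z * \<phi> y w"

definition form_operator :: "('a::euclidean_space \<Rightarrow> 'a \<Rightarrow> real) \<Rightarrow> 'a \<Rightarrow> 'a" where
  "form_operator \<phi> = (THE A. linear A \<and> (\<forall>x y. \<phi> x y = A x \<bullet> y))"

definition eigenspace :: "('a::euclidean_space \<Rightarrow> 'a \<Rightarrow> real) \<Rightarrow> real \<Rightarrow> 'a set" where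
  "eigenspace \<phi> \<mu> = {x. form_operator \<phi> x = \<mu> *\<^sub>R x}"

definition eigenvalues :: "('a::euclidean_space \<Rightarrow> 'a \<Rightarrow> real) \<Rightarrow> real set" where
  "eigenvalues \<phi> = {\<mu>. \<exists>x. x \<noteq> 0 \<and> form_operator \<phi> x = \<mu> *\<^sub>R x}"

text \<open>The multiplicity of an eigenvalue is the dimension of its eigenspace; the operators in
  question are self-adjoint, so this is also the algebraic multiplicity. The sum below ranges
  over a finite set (lemma \<open>finite_eigenvalues\<close>).\<close>

definition eigenvalue_mset :: "('a::euclidean_space \<Rightarrow> 'a \<Rightarrow> real) \<Rightarrow> real multiset" where
  "eigenvalue_mset \<phi> = (\<Sum>\<mu>\<in>eigenvalues \<phi>. replicate_mset (dim (eigenspace \<phi> \<mu>)) \<mu>)"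

definition two_plane :: "'a::euclidean_space set \<Rightarrow> bool" where
  "two_plane \<pi> \<longleftrightarrow> subspace \<pi> \<and> dim \<pi> = 2"

definition plane_basis :: "'a::euclidean_space \<Rightarrow> 'a \<Rightarrow> 'a set \<Rightarrow> bool" where
  "plane_basis x y \<pi> \<longleftrightarrow> x \<noteq> y \<and> independent {x, y} \<and> span {x, y} = \<pi>"

text \<open>The common value over all bases of \<open>\<pi>\<close>; for \<open>canonical_curvature \<phi>\<close> this is
  well-defined by lemmas \<open>plane_basis_exists\<close> and \<open>sectional_curvature_eq\<close>.\<close>

definition sectional_curvature ::
    "('a::euclidean_space \<Rightarrow> 'a \<Rightarrow> 'a \<Rightarrow> 'a \<Rightarrow> real) \<Rightarrow> 'a set \<Rightarrow> real" where
  "sectional_curvature R \<pi> =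
     (THE k. \<forall>x y. plane_basis x y \<pi> \<longrightarrow>
        k = R x y y x / ((x \<bullet> x) * (y \<bullet> y) - (x \<bullet> y)\<^sup>2))"

lemma form_operator_unique:
  fixes \<phi> :: "'a::euclidean_space \<Rightarrow> 'a \<Rightarrow> real"
  assumes "bilinear \<phi>"
  shows "\<exists>!A. linear A \<and> (\<forall>x y. \<phi> x y = A x \<bullet> y)"
proof (rule ex_ex1I)
  have l: "linear (\<lambda>y. \<phi> x y)" "linear (\<lambda>x. \<phi> x y)" for x y
    using assms by (auto simp: bilinear_def)
  define A where "A x = (\<Sum>b\<in>Basis. \<phi> x b *\<^sub>R b)" for x
  have "linear A"
    by (rule linearI)
       (simp_all add: A_def linear_add[OF l(2)] linear_cmul[OF l(2)] scaleR_add_left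
         sum.distrib scaleR_sum_right)
  moreover have "\<phi> x y = A x \<bullet> y" for x y
  proof -
    have "\<phi> x y = \<phi> x (\<Sum>b\<in>Basis. (y \<bullet> b) *\<^sub>R b)"
      by (simp add: euclidean_representation)
    also have "\<dots> = (\<Sum>b\<in>Basis. (y \<bullet> b) * \<phi> x b)"
      by (simp only: linear_sum[OF l(1)] linear_cmul[OF l(1)] real_scaleR_def)
    also have "\<dots> = A x \<bullet> y"
      by (simp add: A_def inner_sum_left inner_commute[of y] mult.commute)
    finally show ?thesis .
  qed
  ultimately show "\<exists>A. linear A \<and> (\<forall>x y. \<phi> x y = A x \<bullet> y)" by blast
next
  fix A B :: "'a \<Rightarrow> 'a"
  assume "linear A \<and> (\<forall>x y. \<phi> x y = A x \<bullet> y)" "linear B \<and> (\<forall>x y. \<phi> x y = B x \<bullet> y)"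
  then have "A x \<bullet> y = B x \<bullet> y" for x y by metis
  then have "A x = B x" for x using vector_eq_rdot by blast
  then show "A = B" by (rule ext)
qed

lemma
  assumes "bilinear \<phi>"
  shows linear_form_operator: "linear (form_operator \<phi>)"
    and form_operator: "\<phi> x y = form_operator \<phi> x \<bullet> y"
proof -
  have *: "linear (form_operator \<phi>) \<and> (\<forall>x y. \<phi> x y = form_operator \<phi> x \<bullet> y)"
    unfolding form_operator_def by (rule theI'[OF form_operator_unique[OF assms]])
  from * show "linear (form_operator \<phi>)" by (rule conjunct1)
  from * show "\<phi> x y = form_operator \<phi> x \<bullet> y" by blast
qed

lemma finite_eigenvalues:
  fixes \<phi> :: "'a::euclidean_space \<Rightarrow> 'a \<Rightarrow> real"
  assumes "bilinear \<phi>" and sym: "\<And>x y. \<phi> x y = \<phi> y x"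
  shows "finite (eigenvalues \<phi>)"
proof -
  have "\<forall>\<mu>\<in>eigenvalues \<phi>. \<exists>x. x \<noteq> 0 \<and> form_operator \<phi> x = \<mu> *\<^sub>R x"
    by (auto simp: eigenvalues_def)
  then obtain v where v0: "\<And>\<mu>. \<mu> \<in> eigenvalues \<phi> \<Longrightarrow> v \<mu> \<noteq> 0"
    and v: "\<And>\<mu>. \<mu> \<in> eigenvalues \<phi> \<Longrightarrow> form_operator \<phi> (v \<mu>) = \<mu> *\<^sub>R v \<mu>"
    by metis
  have orth: "v \<mu> \<bullet> v \<nu> = 0"
    if "\<mu> \<in> eigenvalues \<phi>" "\<nu> \<in> eigenvalues \<phi>" "\<mu> \<noteq> \<nu>" for \<mu> \<nu>
  proof -
    have "\<mu> * (v \<mu> \<bullet> v \<nu>) = \<nu> * (v \<mu> \<bullet> v \<nu>)"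
      using sym[of "v \<mu>" "v \<nu>"] that by (simp add: form_operator[OF assms(1)] v inner_commute)
    then show ?thesis using that by simp
  qed
  have "pairwise orthogonal (v ` eigenvalues \<phi>)"
    using orth unfolding pairwise_def orthogonal_def by (metis imageE)
  then have "finite (v ` eigenvalues \<phi>)"
    using pairwise_orthogonal_imp_finite by blast
  moreover have "inj_on v (eigenvalues \<phi>)"
    by (rule inj_onI) (metis inner_eq_zero_iff orth v0)
  ultimately show ?thesis by (rule finite_imageD)
qed

lemma in_span_pair:
  fixes x y w :: "'a::real_vector"
  assumes "w \<in> span {x, y}"
  shows "\<exists>a b. w = a *\<^sub>R x + b *\<^sub>R y"
proof -
  obtain a where "w - a *\<^sub>R x \<in> span {y}"
    using assms span_breakdown_eq[of w x "{y}"] by blast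
  then obtain b where "w - a *\<^sub>R x = b *\<^sub>R y"
    unfolding span_singleton by blast
  then have "w = a *\<^sub>R x + b *\<^sub>R y" by (simp add: diff_eq_eq add.commute)
  then show ?thesis by blast
qed

lemma plane_basis_exists:
  assumes "two_plane \<pi>"
  shows "\<exists>x y. plane_basis x y \<pi>"
proof -
  have \<pi>: "subspace \<pi>" "dim \<pi> = 2" using assms by (auto simp: two_plane_def)
  obtain B where B: "B \<subseteq> \<pi>" "independent B" "\<pi> \<subseteq> span B" "card B = dim \<pi>"
    using basis_exists[of \<pi>] by metis
  then obtain x y where xy: "B = {x, y}" "x \<noteq> y" using \<pi>(2) card_2_iff[of B] by metis
  have "span B = \<pi>" using B \<pi>(1) span_minimal by blast
  then show ?thesis using xy B(2) unfolding plane_basis_def by blast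
qed

lemma sectional_curvature_eq:
  fixes \<phi> :: "'a::euclidean_space \<Rightarrow> 'a \<Rightarrow> real"
  assumes "bilinear \<phi>" and xy: "plane_basis x y \<pi>"
  shows "sectional_curvature (canonical_curvature \<phi>) \<pi> =
    canonical_curvature \<phi> x y y x / ((x \<bullet> x) * (y \<bullet> y) - (x \<bullet> y)\<^sup>2)"
  unfolding sectional_curvature_def
proof (rule the_equality, intro allI impI)
  fix u v assume uv: "plane_basis u v \<pi>"
  have "u \<in> span {x, y}" "v \<in> span {x, y}"
    using xy uv by (auto simp: plane_basis_def intro: span_base)
  then obtain a b c d where u: "u = a *\<^sub>R x + b *\<^sub>R y" and v: "v = c *\<^sub>R x + d *\<^sub>R y"
    by (meson in_span_pair)
  have det: "a * d - b * c \<noteq> 0"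
  proof
    assume 0: "a * d - b * c = 0"
    have "d *\<^sub>R u - b *\<^sub>R v = (a * d - b * c) *\<^sub>R x" "a *\<^sub>R v - c *\<^sub>R u = (a * d - b * c) *\<^sub>R y"
      by (simp_all add: u v algebra_simps)
    then have e: "d *\<^sub>R u + (- b) *\<^sub>R v = 0" "(- c) *\<^sub>R u + a *\<^sub>R v = 0" using 0 by simp_all
    have ind: "p = 0 \<and> q = 0" if "p *\<^sub>R u + q *\<^sub>R v = 0" for p q
    proof -
      have uv': "u \<noteq> v" "independent {u, v}" using uv by (auto simp: plane_basis_def)
      have s: "(\<Sum>w\<in>{u, v}. (if w = u then p else q) *\<^sub>R w) = 0"
        using that uv'(1) by auto
      have "(if w = u then p else q) = 0" if "w \<in> {u, v}" for w
        by (rule independentD[OF uv'(2) _ subset_refl s that]) simp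
      from this[of u] this[of v] show ?thesis using uv'(1) by auto
    qed
    have "u = 0" using ind[OF e(1)] ind[OF e(2)] by (simp add: u)
    then show False using uv by (auto simp: plane_basis_def dependent_zero)
  qed
  have l: "linear (\<lambda>y. \<phi> x y)" "linear (\<lambda>x. \<phi> x y)" for x y
    using assms by (auto simp: bilinear_def)
  have exp: "\<phi> (p *\<^sub>R x + q *\<^sub>R y) (r *\<^sub>R x + s *\<^sub>R y) =
      p * r * \<phi> x x + p * s * \<phi> x y + q * r * \<phi> y x + q * s * \<phi> y y" for p q r s
    by (simp add: linear_add[OF l(1)] linear_add[OF l(2)] linear_cmul[OF l(1)]
        linear_cmul[OF l(2)] algebra_simps)
  have num: "canonical_curvature \<phi> u v v u = (a * d - b * c)\<^sup>2 * canonical_curvature \<phi> x y y x"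
    unfolding canonical_curvature_def u v exp
    by (simp add: power2_eq_square algebra_simps)
  have den: "(u \<bullet> u) * (v \<bullet> v) - (u \<bullet> v)\<^sup>2 =
      (a * d - b * c)\<^sup>2 * ((x \<bullet> x) * (y \<bullet> y) - (x \<bullet> y)\<^sup>2)"
    unfolding u v inner_add_left inner_add_right inner_scaleR_left inner_scaleR_right
      inner_commute[of y x]
    by (simp add: power2_eq_square algebra_simps)
  show "canonical_curvature \<phi> x y y x / ((x \<bullet> x) * (y \<bullet> y) - (x \<bullet> y)\<^sup>2) =
      canonical_curvature \<phi> u v v u / ((u \<bullet> u) * (v \<bullet> v) - (u \<bullet> v)\<^sup>2)"
    unfolding num den using det by simp
next
  fix k assume "\<forall>x y. plane_basis x y \<pi> \<longrightarrow>
    k = canonical_curvature \<phi> x y y x / ((x \<bullet> x) * (y \<bullet> y) - (x \<bullet> y)\<^sup>2)"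
  then show "k = canonical_curvature \<phi> x y y x / ((x \<bullet> x) * (y \<bullet> y) - (x \<bullet> y)\<^sup>2)"
    using xy by blast
qed

end

theory Submission
  imports Defs "HOL-Combinatorics.Permutations"
begin

text \<open>In an orthonormal eigenbasis Lagrange's identity writes the numerator and the denominator of
  the sectional curvature as sums of the squared Pluecker coordinates of the plane, weighted by
  \<open>\<lambda>\<^sub>i \<lambda>\<^sub>j\<close> and by \<open>1\<close> respectively, so the curvature is a weighted mean of the products
  \<open>\<lambda>\<^sub>i \<lambda>\<^sub>j\<close>. Conversely, a plane spanned by two eigenvectors realising \<open>m\<close> can be deformed
  to one realising \<open>M\<close> through planes with an orthogonal and \<open>\<phi>\<close>-orthogonal basis, and
  the intermediate value theorem applies.\<close>

section \<open>Spectral theorem for self-adjoint operators\<close>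

text \<open>A maximiser \<open>v\<close> of \<open>A x \<bullet> x\<close> on the unit sphere of
  \<open>S\<close> is an eigenvector. Its residual \<open>w = A v - \<mu> *\<^sub>R v\<close> lies
  in \<open>S\<close> by invariance, so moving from \<open>v\<close> along \<open>w\<close> stays
  admissible, and the linear gain \<open>2 * (w \<bullet> w)\<close> must vanish at a
  maximum.\<close>

lemma self_adjoint_eigenvector:
  fixes A :: "'a::euclidean_space \<Rightarrow> 'a"
  assumes lin: "linear A" and sa: "\<And>x y. A x \<bullet> y = x \<bullet> A y"
    and S: "subspace S" "A ` S \<subseteq> S" "S \<noteq> {0}"
  shows "\<exists>v\<in>S. norm v = 1 \<and> A v = (A v \<bullet> v) *\<^sub>R v"
proof -
  let ?K = "sphere 0 1 \<inter> S"
  have "compact ?K"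
    using S(1) by (intro compact_Int_closed compact_sphere closed_subspace)
  moreover have "?K \<noteq> {}"
  proof -
    obtain u where "u \<in> S" "u \<noteq> 0" using S(1,3) subspace_0 by blast
    then have "(1 / norm u) *\<^sub>R u \<in> ?K" using S(1) by (simp add: subspace_scale)
    then show ?thesis by blast
  qed
  moreover have "continuous_on ?K (\<lambda>x. A x \<bullet> x)"
    by (intro continuous_intros linear_continuous_on linear_conv_bounded_linear[THEN iffD1] lin)
  ultimately have "\<exists>v\<in>?K. \<forall>x\<in>?K. A x \<bullet> x \<le> A v \<bullet> v" by (rule continuous_attains_sup)
  then obtain v where v: "v \<in> ?K" and max: "\<And>x. x \<in> ?K \<Longrightarrow> A x \<bullet> x \<le> A v \<bullet> v" by blast
  define \<mu> where "\<mu> = A v \<bullet> v"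
  have vS: "v \<in> S" and v1: "v \<bullet> v = 1" using v by (auto simp: dot_square_norm)
  \<comment> \<open>Homogeneity of degree two carries maximality from the unit sphere to all of
    \<open>S\<close>, so that \<open>v + t *\<^sub>R w\<close> can be tested without normalising
    it.\<close>
  have quad: "A x \<bullet> x \<le> \<mu> * (x \<bullet> x)" if "x \<in> S" for x
  proof (cases "x = 0")
    case True
    then show ?thesis using lin by (simp add: linear_0)
  next
    case False
    have "(1 / norm x) *\<^sub>R x \<in> ?K" using False that S(1) by (simp add: subspace_scale)
    from max[OF this] have "(A x \<bullet> x) / (norm x)\<^sup>2 \<le> \<mu>"
      by (simp add: linear_cmul[OF lin] \<mu>_def power2_eq_square)
    then show ?thesis using False by (simp add: divide_le_eq dot_square_norm)
  qed
  define w where "w = A v - \<mu> *\<^sub>R v"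
  have wS: "w \<in> S" using S(1,2) vS by (auto simp: w_def intro: subspace_diff subspace_scale)
  have wv: "w \<bullet> v = 0" by (simp add: w_def inner_diff_left \<mu>_def v1)
  have Avw: "A v \<bullet> w = w \<bullet> w" "A w \<bullet> v = w \<bullet> w"
    using wv sa[of w v] by (simp_all add: w_def inner_diff_left inner_diff_right inner_commute algebra_simps)
  \<comment> \<open>This is \<open>quad\<close> at \<open>v + t *\<^sub>R w\<close>; the constant
    terms cancel because \<open>A v \<bullet> v = \<mu>\<close> and
    \<open>v \<bullet> v = 1\<close>.\<close>
  have first_order: "2 * t * (w \<bullet> w) + t\<^sup>2 * (A w \<bullet> w - \<mu> * (w \<bullet> w)) \<le> 0" for t
  proof -
    have "v + t *\<^sub>R w \<in> S" using S(1) vS wS by (simp add: subspace_add subspace_scale)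
    from quad[OF this] show ?thesis
      using wv v1 Avw
      by (simp add: linear_add[OF lin] linear_cmul[OF lin] inner_add_left inner_add_right
          inner_commute[of v w] \<mu>_def[symmetric] algebra_simps power2_eq_square)
  qed
  have "w \<bullet> w = 0"
  proof (rule ccontr)
    assume "w \<bullet> w \<noteq> 0"
    then have p: "w \<bullet> w > 0" by (metis inner_gt_zero_iff inner_zero_left)
    \<comment> \<open>The negative of \<open>c\<close> bounds the coefficient of
      \<open>t\<^sup>2\<close> from below, and the summand 1 keeps \<open>c\<close> positive. For
      \<open>t = (w \<bullet> w) / c\<close> the quadratic term then takes away at most half of the
      linear term, leaving a positive value.\<close>
    define c where "c = \<bar>A w \<bullet> w - \<mu> * (w \<bullet> w)\<bar> + 1"
    have c: "c > 0" "A w \<bullet> w - \<mu> * (w \<bullet> w) \<ge> - c" by (auto simp: c_def)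
    let ?t = "(w \<bullet> w) / c"
    have "?t\<^sup>2 * (- c) \<le> ?t\<^sup>2 * (A w \<bullet> w - \<mu> * (w \<bullet> w))"
      by (rule mult_left_mono[OF c(2)]) simp
    moreover have "?t\<^sup>2 * (- c) = - (?t * (w \<bullet> w))" using c(1) by (simp add: power2_eq_square)
    moreover have "?t * (w \<bullet> w) > 0" using c(1) p by simp
    ultimately show False using first_order[of ?t] by linarith
  qed
  then have "A v = \<mu> *\<^sub>R v" by (simp add: w_def)
  then show ?thesis using v \<mu>_def by auto
qed

text \<open>Induction on the dimension: split off a unit eigenvector \<open>v\<close> and pass to
  its orthogonal complement \<open>T\<close> in \<open>S\<close>. Self-adjointness keeps
  \<open>T\<close> invariant, since \<open>v \<bullet> A x\<close> is a multiple of
  \<open>v \<bullet> x\<close>.\<close>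

lemma self_adjoint_orthonormal_eigenbasis:
  fixes A :: "'a::euclidean_space \<Rightarrow> 'a"
  assumes lin: "linear A" and sa: "\<And>x y. A x \<bullet> y = x \<bullet> A y"
    and "subspace S" "A ` S \<subseteq> S"
  shows "\<exists>B. pairwise orthogonal B \<and> span B = S \<and>
    (\<forall>b\<in>B. norm b = 1 \<and> A b = (A b \<bullet> b) *\<^sub>R b)"
  using assms(3,4)
proof (induction "dim S" arbitrary: S rule: less_induct)
  case less
  show ?case
  proof (cases "S = {0}")
    case True
    then show ?thesis by (intro exI[of _ "{}"]) simp
  next
    case False
    obtain v where v: "v \<in> S" "norm v = 1" "A v = (A v \<bullet> v) *\<^sub>R v"
      using self_adjoint_eigenvector[OF lin sa less.prems False] by blast
    define T where "T = {x \<in> S. v \<bullet> x = 0}"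
    have T: "subspace T"
      using subspace_inter[OF less.prems(1) subspace_hyperplane[of v]]
      by (simp add: T_def Int_def)
    have "A x \<in> T" if "x \<in> T" for x
    proof -
      have "v \<bullet> A x = ((A v \<bullet> v) *\<^sub>R v) \<bullet> x" using sa v(3) by metis
      then show ?thesis using that less.prems(2) by (auto simp: T_def)
    qed
    then have AT: "A ` T \<subseteq> T" by blast
    have "v \<notin> T" using v(2) by (auto simp: T_def dot_square_norm)
    then have "T \<subset> S" using v(1) unfolding T_def by blast
    then have "dim T < dim S"
      using T less.prems(1) by (intro dim_psubset) (simp add: span_eq_iff[THEN iffD2])
    from less.hyps[OF this T AT] obtain B where B: "pairwise orthogonal B" "span B = T"
      "\<And>b. b \<in> B \<Longrightarrow> norm b = 1 \<and> A b = (A b \<bullet> b) *\<^sub>R b" by blast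
    have BT: "B \<subseteq> T" using B(2) span_superset by blast
    have "pairwise orthogonal (insert v B)"
      using B(1) BT by (auto simp: pairwise_insert T_def orthogonal_def inner_commute)
    moreover have "span (insert v B) = S"
    proof
      show "span (insert v B) \<subseteq> S"
        using BT v(1) less.prems(1) by (intro span_minimal) (auto simp: T_def)
      show "S \<subseteq> span (insert v B)"
      proof
        fix x assume x: "x \<in> S"
        have "x - (v \<bullet> x) *\<^sub>R v \<in> T"
          using x v(1,2) less.prems(1)
          by (simp add: T_def subspace_diff subspace_scale inner_diff_right dot_square_norm)
        then show "x \<in> span (insert v B)" using B(2) span_breakdown_eq by blast
      qed
    qed
    ultimately show ?thesis using v B(3) by (intro exI[of _ "insert v B"]) auto
  qed
qed

section \<open>Orthonormal eigenbases and eigenvalue multiplicities\<close>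

lemma orthonormal_independent:
  fixes B :: "'a::real_inner set"
  assumes "pairwise orthogonal B" "\<And>b. b \<in> B \<Longrightarrow> norm b = 1"
  shows "independent B"
  using assms by (metis norm_zero pairwise_orthogonal_independent zero_neq_one)

text \<open>The residual \<open>x - ?s\<close> is orthogonal to \<open>span B\<close> and also lies
  in it, hence is orthogonal to itself.\<close>

lemma orthonormal_basis_expansion:
  fixes x :: "'a::euclidean_space"
  assumes "pairwise orthogonal B" "\<And>b. b \<in> B \<Longrightarrow> norm b = 1" "x \<in> span B"
  shows "x = (\<Sum>b\<in>B. (x \<bullet> b) *\<^sub>R b)"
proof -
  let ?s = "\<Sum>b\<in>B. (x \<bullet> b) *\<^sub>R b"
  have "(\<Sum>b\<in>B. (b \<bullet> x / (b \<bullet> b)) *\<^sub>R b) = ?s"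
    using assms(2) by (intro sum.cong) (auto simp: dot_square_norm inner_commute)
  then have orth: "(x - ?s) \<bullet> y = 0" if "y \<in> span B" for y
    using Gram_Schmidt_step[OF assms(1) that, of x]
    by (simp add: orthogonal_def inner_commute)
  have "x - ?s \<in> span B"
    by (intro span_diff[OF assms(3)] span_sum span_scale span_base)
  from orth[OF this] show ?thesis by simp
qed

text \<open>Expanding \<open>form_operator \<phi> x = \<mu> *\<^sub>R x\<close> in the eigenbasis
  and comparing coefficients gives \<open>(ev b - \<mu>) * (x \<bullet> b) = 0\<close>, so only
  basis vectors with eigenvalue \<open>\<mu>\<close> contribute. If \<open>\<mu>\<close> is not an
  eigenvalue, both sides are \<open>{0}\<close>.\<close>

lemma eigenspace_eq_span:
  fixes \<phi> :: "'a::euclidean_space \<Rightarrow> 'a \<Rightarrow> real"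
  assumes "bilinear \<phi>"
    and B: "pairwise orthogonal B" "\<And>b. b \<in> B \<Longrightarrow> norm b = 1" "span B = UNIV"
    and ev: "\<And>b. b \<in> B \<Longrightarrow> form_operator \<phi> b = ev b *\<^sub>R b"
  shows "eigenspace \<phi> \<mu> = span {b \<in> B. ev b = \<mu>}"
proof
  let ?A = "form_operator \<phi>"
  have lin: "linear ?A" using assms(1) by (rule linear_form_operator)
  have fin: "finite B" using B(1) by (rule pairwise_orthogonal_imp_finite)
  have ind: "independent B" using B(1,2) by (rule orthonormal_independent)
  have expand: "x = (\<Sum>b\<in>B. (x \<bullet> b) *\<^sub>R b)" for x
    using orthonormal_basis_expansion[OF B(1,2)] B(3) by blast
  show "span {b \<in> B. ev b = \<mu>} \<subseteq> eigenspace \<phi> \<mu>"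
  proof (rule span_minimal)
    show "{b \<in> B. ev b = \<mu>} \<subseteq> eigenspace \<phi> \<mu>" using ev by (auto simp: eigenspace_def)
    show "subspace (eigenspace \<phi> \<mu>)"
      by (auto simp: subspace_def eigenspace_def linear_0[OF lin] linear_add[OF lin]
          linear_cmul[OF lin] algebra_simps)
  qed
  show "eigenspace \<phi> \<mu> \<subseteq> span {b \<in> B. ev b = \<mu>}"
  proof
    fix x assume "x \<in> eigenspace \<phi> \<mu>"
    then have x: "?A x = \<mu> *\<^sub>R x" by (simp add: eigenspace_def)
    have "(\<Sum>b\<in>B. ((ev b - \<mu>) * (x \<bullet> b)) *\<^sub>R b) =
        (\<Sum>b\<in>B. (x \<bullet> b) *\<^sub>R (ev b *\<^sub>R b)) - \<mu> *\<^sub>R (\<Sum>b\<in>B. (x \<bullet> b) *\<^sub>R b)"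
      by (simp add: scaleR_sum_right sum_subtractf[symmetric] algebra_simps)
    also have "(\<Sum>b\<in>B. (x \<bullet> b) *\<^sub>R (ev b *\<^sub>R b)) = ?A (\<Sum>b\<in>B. (x \<bullet> b) *\<^sub>R b)"
      unfolding linear_sum[OF lin] linear_cmul[OF lin] using ev by (intro sum.cong) simp_all
    finally have "(\<Sum>b\<in>B. ((ev b - \<mu>) * (x \<bullet> b)) *\<^sub>R b) = 0"
      using x by (simp flip: expand)
    then have zero: "(ev b - \<mu>) * (x \<bullet> b) = 0" if "b \<in> B" for b
      using independentD[OF ind fin subset_refl _ that, of "\<lambda>b. (ev b - \<mu>) * (x \<bullet> b)"]
      by blast
    have "(x \<bullet> b) *\<^sub>R b \<in> span {b \<in> B. ev b = \<mu>}" if "b \<in> B" for b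
      using zero[OF that] that by (cases "ev b = \<mu>") (auto intro: span_scale span_base span_zero)
    then have "(\<Sum>b\<in>B. (x \<bullet> b) *\<^sub>R b) \<in> span {b \<in> B. ev b = \<mu>}" by (rule span_sum)
    then show "x \<in> span {b \<in> B. ev b = \<mu>}" using expand[of x] by simp
  qed
qed

text \<open>Translates multiplicities, defined as dimensions of eigenspaces, into a count of basis
  vectors: by \<open>eigenspace_eq_span\<close> each eigenspace has the basis vectors with that
  eigenvalue as its own basis.\<close>

lemma eigenvalue_mset_eq:
  fixes \<phi> :: "'a::euclidean_space \<Rightarrow> 'a \<Rightarrow> real"
  assumes "bilinear \<phi>"
    and B: "pairwise orthogonal B" "\<And>b. b \<in> B \<Longrightarrow> norm b = 1" "span B = UNIV"
    and ev: "\<And>b. b \<in> B \<Longrightarrow> form_operator \<phi> b = ev b *\<^sub>R b"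
  shows "eigenvalue_mset \<phi> = image_mset ev (mset_set B)"
proof -
  have fin: "finite B" using B(1) by (rule pairwise_orthogonal_imp_finite)
  have ind: "independent B" using B(1,2) by (rule orthonormal_independent)
  note es = eigenspace_eq_span[OF assms]
  have dim: "dim (eigenspace \<phi> \<mu>) = card {b \<in> B. ev b = \<mu>}" for \<mu>
  proof -
    have "independent {b \<in> B. ev b = \<mu>}" by (rule independent_mono[OF ind]) blast
    then show ?thesis by (simp add: es dim_eq_card_independent)
  qed
  have evs: "eigenvalues \<phi> = ev ` B"
  proof
    show "ev ` B \<subseteq> eigenvalues \<phi>"
    proof
      fix \<mu> assume "\<mu> \<in> ev ` B"
      then obtain b where "b \<in> B" "\<mu> = ev b" by blast
      then show "\<mu> \<in> eigenvalues \<phi>"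
        using ev[of b] B(2)[of b] by (auto simp: eigenvalues_def intro!: exI[of _ b])
    qed
    show "eigenvalues \<phi> \<subseteq> ev ` B"
    proof
      fix \<mu> assume "\<mu> \<in> eigenvalues \<phi>"
      then obtain x where x: "x \<noteq> 0" "x \<in> eigenspace \<phi> \<mu>"
        by (auto simp: eigenvalues_def eigenspace_def)
      have "{b \<in> B. ev b = \<mu>} \<noteq> {}"
      proof
        assume "{b \<in> B. ev b = \<mu>} = {}"
        then have "eigenspace \<phi> \<mu> = {0}" by (simp only: es span_empty)
        with x show False by simp
      qed
      then show "\<mu> \<in> ev ` B" by blast
    qed
  qed
  show ?thesis
  proof (rule multiset_eqI)
    fix \<mu>
    have "count (eigenvalue_mset \<phi>) \<mu> =
        (\<Sum>\<nu>\<in>ev ` B. if \<nu> = \<mu> then card {b \<in> B. ev b = \<mu>} else 0)"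
      unfolding eigenvalue_mset_def evs count_sum by (intro sum.cong) (auto simp: dim)
    also have "\<dots> = card {b \<in> B. ev b = \<mu>}"
    proof (cases "\<mu> \<in> ev ` B")
      case False
      then have "{b \<in> B. ev b = \<mu>} = {}" by blast
      with False fin show ?thesis by (simp add: sum.delta)
    qed (use fin in \<open>simp add: sum.delta\<close>)
    also have "\<dots> = count (image_mset ev (mset_set B)) \<mu>"
    proof -
      have "ev -` {\<mu>} \<inter> B = {b \<in> B. ev b = \<mu>}" by blast
      then show ?thesis using fin by (simp add: count_image_mset)
    qed
    finally show "count (eigenvalue_mset \<phi>) \<mu> = count (image_mset ev (mset_set B)) \<mu>" .
  qed
qed

text \<open>The list \<open>lam\<close> comes in an arbitrary order, so the eigenbasis has to be
  enumerated in such a way that its vector number \<open>i\<close> belongs to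
  \<open>lam ! i\<close>.\<close>

lemma eigenvalue_list_orthonormal_basis:
  fixes \<phi> :: "'a::euclidean_space \<Rightarrow> 'a \<Rightarrow> real"
  assumes bil: "bilinear \<phi>" and sym: "\<And>x y. \<phi> x y = \<phi> y x"
    and lam: "mset lam = eigenvalue_mset \<phi>"
  obtains e where "\<And>i j. i < DIM('a) \<Longrightarrow> j < DIM('a) \<Longrightarrow> e i \<bullet> e j = (if i = j then 1 else 0)"
    and "\<And>x. x = (\<Sum>i<DIM('a). (x \<bullet> e i) *\<^sub>R e i)"
    and "\<And>i x. i < DIM('a) \<Longrightarrow> \<phi> (e i) x = lam ! i * (e i \<bullet> x)"
proof -
  let ?A = "form_operator \<phi>"
  have sa: "?A x \<bullet> y = x \<bullet> ?A y" for x y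
    using sym[of x y] by (simp add: form_operator[OF bil] inner_commute)
  obtain B where B: "pairwise orthogonal B" "span B = UNIV"
    "\<And>b. b \<in> B \<Longrightarrow> norm b = 1" "\<And>b. b \<in> B \<Longrightarrow> ?A b = (?A b \<bullet> b) *\<^sub>R b"
    using self_adjoint_orthonormal_eigenbasis[OF linear_form_operator[OF bil] sa, of UNIV] by auto
  define ev where "ev b = ?A b \<bullet> b" for b
  have fin: "finite B" using B(1) by (rule pairwise_orthogonal_imp_finite)
  have ind: "independent B" using B(1,3) by (rule orthonormal_independent)
  have card: "card B = DIM('a)" using dim_eq_card[OF _ ind, of UNIV] B(2) by simp
  obtain bs where bs: "set bs = B" "distinct bs" using finite_distinct_list[OF fin] by blast
  have ms: "mset (map ev bs) = mset lam"
    using eigenvalue_mset_eq[OF bil B(1,3,2), of ev] B(4) bs lam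
    by (simp add: ev_def mset_set_set[symmetric])
  \<comment> \<open>Lists with equal multisets differ by a permutation; the one found for the
    eigenvalues is then applied to the vectors.\<close>
  obtain p where p: "p permutes {..<length bs}" and plam: "permute_list p (map ev bs) = lam"
    using mset_eq_permutation[OF ms[symmetric]] by auto
  have len: "length bs = DIM('a)" using bs card distinct_card by metis
  define es where "es = permute_list p bs"
  have es: "set es = B" "distinct es" "length es = DIM('a)"
    using p bs len by (simp_all add: es_def)
  have lam_eq: "lam = map ev es" using plam p by (simp add: es_def permute_list_map)
  have inB: "es ! i \<in> B" if "i < DIM('a)" for i using that es by (metis nth_mem)
  show ?thesis
  proof (rule that[of "\<lambda>i. es ! i"])
    fix i j assume ij: "i < DIM('a)" "j < DIM('a)"
    then have "es ! i = es ! j \<longleftrightarrow> i = j" using es by (simp add: nth_eq_iff_index_eq)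
    then show "es ! i \<bullet> es ! j = (if i = j then 1 else 0)"
      using inB[OF ij(1)] inB[OF ij(2)] B(1,3)
      by (auto simp: pairwise_def orthogonal_def dot_square_norm)
  next
    fix x
    have "bij_betw ((!) es) {..<DIM('a)} B" using bij_betw_nth[OF es(2)] es by simp
    then show "x = (\<Sum>i<DIM('a). (x \<bullet> es ! i) *\<^sub>R es ! i)"
      using orthonormal_basis_expansion[OF B(1,3), of x] B(2)
      by (simp add: sum.reindex_bij_betw[where g="\<lambda>b. (x \<bullet> b) *\<^sub>R b"])
  next
    fix i x assume i: "i < DIM('a)"
    then show "\<phi> (es ! i) x = lam ! i * (es ! i \<bullet> x)"
      using B(4)[OF inB[OF i]] es(3)
      by (metis form_operator[OF bil] ev_def lam_eq nth_map inner_scaleR_left)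
  qed
qed

section \<open>Lagrange's identity and Gram determinants\<close>

text \<open>Expanding the square splits the double sum into products of single sums. The factor 2
  appears because the sum runs over ordered pairs. Weights \<open>a i = 1\<close> will give the Gram
  determinant, eigenvalues as weights the numerator of the curvature.\<close>

lemma weighted_lagrange_identity:
  fixes a x y :: "'i \<Rightarrow> real"
  shows "2 * ((\<Sum>i\<in>I. a i * (x i)\<^sup>2) * (\<Sum>i\<in>I. a i * (y i)\<^sup>2) - (\<Sum>i\<in>I. a i * x i * y i)\<^sup>2) =
    (\<Sum>i\<in>I. \<Sum>j\<in>I. a i * a j * (x i * y j - x j * y i)\<^sup>2)"
proof -
  have "(\<Sum>i\<in>I. \<Sum>j\<in>I. a i * a j * (x i * y j - x j * y i)\<^sup>2) =
    (\<Sum>i\<in>I. \<Sum>j\<in>I. (a i * (x i)\<^sup>2) * (a j * (y j)\<^sup>2) + (a i * (y i)\<^sup>2) * (a j * (x j)\<^sup>2)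
        - 2 * ((a i * x i * y i) * (a j * x j * y j)))"
    by (intro sum.cong refl) (simp add: power2_eq_square algebra_simps)
  also have "\<dots> = (\<Sum>i\<in>I. a i * (x i)\<^sup>2) * (\<Sum>i\<in>I. a i * (y i)\<^sup>2)
      + (\<Sum>i\<in>I. a i * (y i)\<^sup>2) * (\<Sum>i\<in>I. a i * (x i)\<^sup>2) - 2 * (\<Sum>i\<in>I. a i * x i * y i)\<^sup>2"
    unfolding sum_subtractf sum.distrib power2_eq_square sum_product
    by (simp add: sum_distrib_left)
  finally show ?thesis by simp
qed

text \<open>The equality case of Cauchy-Schwarz: the squared norm of \<open>?z\<close> is
  \<open>y \<bullet> y\<close> times the Gram determinant, so a vanishing determinant makes
  \<open>x\<close> a multiple of \<open>y\<close>.\<close>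

lemma independent_pair_gram_pos:
  fixes x y :: "'a::real_inner"
  assumes "x \<noteq> y" "independent {x, y}"
  shows "(x \<bullet> x) * (y \<bullet> y) - (x \<bullet> y)\<^sup>2 > 0"
proof (rule ccontr)
  assume "\<not> ?thesis"
  then have 0: "(x \<bullet> x) * (y \<bullet> y) - (x \<bullet> y)\<^sup>2 = 0"
    using Cauchy_Schwarz_ineq[of x y] by linarith
  let ?z = "(y \<bullet> y) *\<^sub>R x - (x \<bullet> y) *\<^sub>R y"
  have "?z \<bullet> ?z = (y \<bullet> y) * ((x \<bullet> x) * (y \<bullet> y) - (x \<bullet> y)\<^sup>2)"
    by (simp add: inner_diff_left inner_diff_right inner_commute[of y x] power2_eq_square
        algebra_simps)
  then have z: "(y \<bullet> y) *\<^sub>R x = (x \<bullet> y) *\<^sub>R y" using 0 by simp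
  have "y \<noteq> 0" "x \<notin> span {y}" using assms by (auto simp: independent_insert)
  have "x = ((x \<bullet> y) / (y \<bullet> y)) *\<^sub>R y"
    using arg_cong[OF z, of "\<lambda>v. (1 / (y \<bullet> y)) *\<^sub>R v"] \<open>y \<noteq> 0\<close> by simp
  then have "x \<in> span {y}" by (metis span_base span_scale singletonI)
  with \<open>x \<notin> span {y}\<close> show False by blast
qed

lemma orthogonal_plane_basis:
  fixes x y :: "'a::euclidean_space"
  assumes "x \<noteq> 0" "y \<noteq> 0" "x \<bullet> y = 0"
  shows "plane_basis x y (span {x, y})" and "two_plane (span {x, y})"
proof -
  have ne: "x \<noteq> y" using assms by auto
  have ind: "independent {x, y}"
    using assms
    by (intro pairwise_orthogonal_independent)
      (auto simp: pairwise_insert orthogonal_def inner_commute)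
  show "plane_basis x y (span {x, y})" using ne ind by (simp add: plane_basis_def)
  show "two_plane (span {x, y})"
    using ne by (simp add: two_plane_def dim_eq_card_independent[OF ind])
qed

section \<open>Curvature in the coordinates of an orthonormal eigenbasis\<close>

context
  fixes \<phi> :: "'a::euclidean_space \<Rightarrow> 'a \<Rightarrow> real" and e :: "nat \<Rightarrow> 'a" and l :: "nat \<Rightarrow> real"
  assumes bil: "bilinear \<phi>"
    and on: "\<And>i j. i < DIM('a) \<Longrightarrow> j < DIM('a) \<Longrightarrow> e i \<bullet> e j = (if i = j then 1 else 0)"
    and expand: "\<And>x. x = (\<Sum>i<DIM('a). (x \<bullet> e i) *\<^sub>R e i)"
    and eig: "\<And>i x. i < DIM('a) \<Longrightarrow> \<phi> (e i) x = l i * (e i \<bullet> x)"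
begin

lemma diagonal_form: "\<phi> x y = (\<Sum>i<DIM('a). l i * (x \<bullet> e i) * (y \<bullet> e i))"
proof -
  have lin: "linear (\<lambda>x. \<phi> x y)" using bil by (auto simp: bilinear_def)
  have "\<phi> x y = \<phi> (\<Sum>i<DIM('a). (x \<bullet> e i) *\<^sub>R e i) y" using expand[of x] by simp
  also have "\<dots> = (\<Sum>i<DIM('a). l i * (x \<bullet> e i) * (y \<bullet> e i))"
    unfolding linear_sum[OF lin] linear_cmul[OF lin]
    by (intro sum.cong refl) (simp add: eig inner_commute)
  finally show ?thesis .
qed

lemma inner_coordinates: "x \<bullet> y = (\<Sum>i<DIM('a). (x \<bullet> e i) * (y \<bullet> e i))"
proof -
  have "x \<bullet> y = (\<Sum>i<DIM('a). (x \<bullet> e i) *\<^sub>R e i) \<bullet> y" using expand[of x] by simp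
  then show ?thesis by (simp only: inner_sum_left inner_scaleR_left inner_commute[of y])
qed

lemma sectional_curvature_bounds:
  assumes "two_plane \<pi>"
    and bnd: "\<And>i j. i < DIM('a) \<Longrightarrow> j < DIM('a) \<Longrightarrow> i \<noteq> j \<Longrightarrow> m \<le> l i * l j \<and> l i * l j \<le> M"
  shows "sectional_curvature (canonical_curvature \<phi>) \<pi> \<in> {m..M}"
proof -
  obtain x y where xy: "plane_basis x y \<pi>" using plane_basis_exists[OF assms(1)] by blast
  define D where "D = (x \<bullet> x) * (y \<bullet> y) - (x \<bullet> y)\<^sup>2"
  define N where "N = canonical_curvature \<phi> x y y x"
  \<comment> \<open>Squared Pluecker coordinates of the plane in the basis \<open>e\<close>.\<close>
  define P where "P i j = ((x \<bullet> e i) * (y \<bullet> e j) - (x \<bullet> e j) * (y \<bullet> e i))\<^sup>2" for i j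
  let ?I = "{..<DIM('a)}"
  have D: "2 * D = (\<Sum>i\<in>?I. \<Sum>j\<in>?I. P i j)"
    using weighted_lagrange_identity[where a="\<lambda>_. 1" and I="?I" and x="\<lambda>i. x \<bullet> e i" and y="\<lambda>i. y \<bullet> e i"]
    unfolding D_def P_def inner_coordinates[of x x] inner_coordinates[of y y]
      inner_coordinates[of x y] by (simp add: power2_eq_square)
  \<comment> \<open>Symmetry is read off the diagonal form; it turns
    \<open>\<phi> x y * \<phi> y x\<close> into the square that Lagrange's identity expects.\<close>
  have sym: "\<phi> y x = \<phi> x y" unfolding diagonal_form by (simp add: mult_ac)
  have N: "2 * N = (\<Sum>i\<in>?I. \<Sum>j\<in>?I. l i * l j * P i j)"
    using weighted_lagrange_identity[where a=l and I="?I" and x="\<lambda>i. x \<bullet> e i" and y="\<lambda>i. y \<bullet> e i"]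
    unfolding N_def P_def canonical_curvature_def sym
    unfolding diagonal_form[of x x] diagonal_form[of y y] diagonal_form[of x y]
    by (simp add: power2_eq_square mult.assoc)
  \<comment> \<open>Diagonal terms vanish with \<open>P i i\<close>, so bounds on products with
    distinct indices suffice; elsewhere they are multiplied by \<open>P i j \<ge> 0\<close>.\<close>
  have summand: "m * P i j \<le> l i * l j * P i j" "l i * l j * P i j \<le> M * P i j"
    if "i \<in> ?I" "j \<in> ?I" for i j
  proof -
    have "P i j \<ge> 0" "i = j \<Longrightarrow> P i j = 0" by (simp_all add: P_def)
    then show "m * P i j \<le> l i * l j * P i j" "l i * l j * P i j \<le> M * P i j"
      using bnd[of i j] that by (cases "i = j"; simp add: mult_right_mono)+
  qed
  have "m * (2 * D) \<le> 2 * N" unfolding D N sum_distrib_left by (intro sum_mono summand)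
  moreover have "2 * N \<le> M * (2 * D)" unfolding D N sum_distrib_left by (intro sum_mono summand)
  moreover have "D > 0"
    unfolding D_def using xy by (intro independent_pair_gram_pos) (auto simp: plane_basis_def)
  ultimately show ?thesis
    unfolding sectional_curvature_eq[OF bil xy] D_def[symmetric] N_def[symmetric]
    by (simp add: field_simps)
qed

text \<open>Move \<open>e i\<close> to \<open>e k\<close> and \<open>e j\<close> to
  \<open>e h\<close> along segments. The four inequalities make \<open>{i, k}\<close> and
  \<open>{j, h}\<close> disjoint, so the moving vectors stay orthogonal and
  \<open>\<phi>\<close>-orthogonal, and the curvature is a product of two Rayleigh quotients,
  continuous in \<open>t\<close>. The cases \<open>i = k\<close> and \<open>j = h\<close> are
  allowed: that vector then stays fixed.\<close>

lemma sectional_curvature_attained: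
  assumes ijkl: "i < DIM('a)" "j < DIM('a)" "k < DIM('a)" "h < DIM('a)"
    and ne: "i \<noteq> j" "k \<noteq> h" "i \<noteq> h" "j \<noteq> k"
    and c: "l i * l j \<le> c" "c \<le> l k * l h"
  shows "\<exists>\<pi>. two_plane \<pi> \<and> sectional_curvature (canonical_curvature \<phi>) \<pi> = c"
proof -
  define x where "x t = (1 - t) *\<^sub>R e i + t *\<^sub>R e k" for t
  define y where "y t = (1 - t) *\<^sub>R e j + t *\<^sub>R e h" for t
  have lin: "linear (\<lambda>u. \<phi> u v)" "linear (\<lambda>v. \<phi> u v)" for u v
    using bil by (auto simp: bilinear_def)
  note e = ijkl ne ne[symmetric] on eig
  have orth: "x t \<bullet> y t = 0" for t
    by (simp add: x_def y_def inner_add_left inner_add_right e)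
  have \<phi>xy: "\<phi> (x t) (y t) = 0" for t
    by (simp add: x_def y_def linear_add[OF lin(1)] linear_add[OF lin(2)] linear_cmul[OF lin(1)]
        linear_cmul[OF lin(2)] e)
  have \<phi>yx: "\<phi> (y t) (x t) = 0" for t
    by (simp add: x_def y_def linear_add[OF lin(1)] linear_add[OF lin(2)] linear_cmul[OF lin(1)]
        linear_cmul[OF lin(2)] e)
  \<comment> \<open>For distinct \<open>p\<close> and \<open>q\<close> the coefficients
    \<open>1 - t\<close> and \<open>t\<close> cannot both be zero; for \<open>p = q\<close> the
    combination is \<open>e p\<close> itself.\<close>
  have nz: "(1 - t) *\<^sub>R e p + t *\<^sub>R e q \<noteq> 0" if "p < DIM('a)" "q < DIM('a)" for p q t
  proof
    assume 0: "(1 - t) *\<^sub>R e p + t *\<^sub>R e q = 0"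
    show False
      using arg_cong[OF 0, of "\<lambda>v. v \<bullet> e p"] arg_cong[OF 0, of "\<lambda>v. v \<bullet> e q"] that
      by (simp add: inner_add_left on split: if_splits)
  qed
  have x0: "x t \<noteq> 0" and y0: "y t \<noteq> 0" for t using nz ijkl by (simp_all add: x_def y_def)
  define f where "f t = \<phi> (x t) (x t) * \<phi> (y t) (y t) / ((x t \<bullet> x t) * (y t \<bullet> y t))" for t
  have curv: "sectional_curvature (canonical_curvature \<phi>) (span {x t, y t}) = f t" for t
    unfolding sectional_curvature_eq[OF bil orthogonal_plane_basis(1)[OF x0 y0 orth]]
    by (simp add: canonical_curvature_def \<phi>xy \<phi>yx orth f_def)
  \<comment> \<open>In the diagonal form \<open>\<phi> (u t) (u t)\<close> is a finite sum of
    products of coordinates of \<open>u t\<close>.\<close>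
  have cont: "continuous_on {0..1} (\<lambda>t. \<phi> (u t) (u t))"
    if "continuous_on {0..1} u" for u :: "real \<Rightarrow> 'a"
    unfolding diagonal_form by (intro continuous_intros that)
  have "continuous_on {0..1} x" "continuous_on {0..1} y"
    unfolding x_def y_def by (intro continuous_intros)+
  then have "continuous_on {0..1} f"
    unfolding f_def using x0 y0 by (intro continuous_intros cont) auto
  moreover have "f 0 = l i * l j" "f 1 = l k * l h"
    by (simp_all add: f_def x_def y_def e)
  ultimately obtain t where "f t = c" using IVT'[of f 0 c 1] c by auto
  then show ?thesis using curv orthogonal_plane_basis(2)[OF x0 y0 orth] by blast
qed

end

theorem theorem1p1:
  fixes \<phi> :: "'a::euclidean_space \<Rightarrow> 'a \<Rightarrow> real"
    and lam :: "real list"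
    and m M :: real
  assumes "DIM('a) \<ge> 2"
    and "bilinear \<phi>"
    and "\<And>x y. \<phi> x y = \<phi> y x"
    and "mset lam = eigenvalue_mset \<phi>"
    and "m = Min {lam ! i * lam ! j | i j. i < DIM('a) \<and> j < DIM('a) \<and> i \<noteq> j}"
    and "M = Max {lam ! i * lam ! j | i j. i < DIM('a) \<and> j < DIM('a) \<and> i \<noteq> j}"
  shows "{sectional_curvature (canonical_curvature \<phi>) \<pi> | \<pi>. two_plane \<pi>} = {m..M}"
proof -
  let ?P = "{lam ! i * lam ! j | i j. i < DIM('a) \<and> j < DIM('a) \<and> i \<noteq> j}"
  obtain e where "\<And>i j. i < DIM('a) \<Longrightarrow> j < DIM('a) \<Longrightarrow> e i \<bullet> e j = (if i = j then 1 else 0)"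
    and "\<And>x. x = (\<Sum>i<DIM('a). (x \<bullet> e i) *\<^sub>R e i)"
    and "\<And>i x. i < DIM('a) \<Longrightarrow> \<phi> (e i) x = lam ! i * (e i \<bullet> x)"
    using eigenvalue_list_orthonormal_basis[OF assms(2-4)] by metis
  note basis = assms(2) this
  \<comment> \<open>\<open>Min\<close> and \<open>Max\<close> bound the products and are attained
    because the set is finite and nonempty; dimension at least 2 supplies the index pair 0,
    1.\<close>
  have fin: "finite ?P"
    by (rule finite_subset[of _ "(\<lambda>(i, j). lam ! i * lam ! j) ` ({..<DIM('a)} \<times> {..<DIM('a)})"]) auto
  have "lam ! 0 * lam ! 1 \<in> ?P" using assms(1) by fastforce
  then have ne: "?P \<noteq> {}" by blast
  have bnd: "m \<le> lam ! i * lam ! j \<and> lam ! i * lam ! j \<le> M"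
    if "i < DIM('a)" "j < DIM('a)" "i \<noteq> j" for i j
  proof -
    have "lam ! i * lam ! j \<in> ?P" using that by blast
    then show ?thesis using fin by (simp add: assms(5,6))
  qed
  have "m \<in> ?P" "M \<in> ?P" unfolding assms(5,6) using fin ne by (rule Min_in Max_in)+
  then obtain i j k h where ij: "i < DIM('a)" "j < DIM('a)" "i \<noteq> j" "m = lam ! i * lam ! j"
    and kh: "k < DIM('a)" "h < DIM('a)" "k \<noteq> h" "M = lam ! k * lam ! h"
    by blast
  have "\<exists>\<pi>. two_plane \<pi> \<and> sectional_curvature (canonical_curvature \<phi>) \<pi> = c"
    if "c \<in> {m..M}" for c
    \<comment> \<open>If the planes share an axis, ordering the pairs so that it stays fixed keeps the
      moving basis orthogonal.\<close>
  proof (cases "i = h \<or> j = k")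
    case True
    then have "i \<noteq> k" "j \<noteq> h" using ij kh by auto
    then show ?thesis
      using sectional_curvature_attained[OF basis, of i j h k c] ij kh that
      by (simp add: mult.commute)
  next
    case False
    then show ?thesis
      using sectional_curvature_attained[OF basis, of i j k h c] ij kh that by simp
  qed
  moreover have "sectional_curvature (canonical_curvature \<phi>) \<pi> \<in> {m..M}" if "two_plane \<pi>" for \<pi>
    using sectional_curvature_bounds[OF basis that bnd] .
  ultimately show ?thesis by blast
qed

end
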